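(* Let $z\in\mathbb C$ and suppose that a sequence $f(z)=(f_n(z))$ satisfies the Jacobi equation $$a_{n-1}F_{n-1}+b_nF_n+a_nF_{n+1}=zF_n .$$ Let $n_0\in\mathbb Z_+$ be such that $f_n(z)\neq 0$ for all $n\ge n_0-1$. Then the sequence $g(z)=(g_n(z))$ defined by $$g_n(z)=f_n(z)G_n(z),\qquad G_n(z)=\sum_{m=n_0}^n\big(a_{m-1}f_{m-1}(z)f_m(z)\big)^{-1},\qquad n\ge n_0,$$ satisfies the same equation, and the Wronskian $\{f(z),g(z)\}=1$. In particular, the solutions $f(z)$ and $g(z)$ are linearly independent.
   Context: $\mathbb Z_+=\{0,1,2,\dots\}$; $a_n>0$, $b_n\in\mathbb R$ for $n\in\mathbb Z_+$, and by convention $a_{-1}=1/2$. The Jacobi equation is imposed for $n\in\mathbb Z_+$ on sequences indexed by $n\ge-1$. The sequence $g$ is given for $n\ge n_0$, and the equation for it is understood for $n\ge n_0+1$ (two consecutive values determine a solution, so it extends uniquely to a solution for all $n\ge-1$). The Wronskian of two solutions is $\{f,g\}=a_n(f_ng_{n+1}-f_{n+1}g_n)$, which does not depend on $n$. *)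

theory Defs
  imports Complex_Main
begin

(* Sequences indexed by n >= -1 are functions on int; their values below -1 are junk and
   are never inspected. *)

definition jacobi_eq ::
  "(int \<Rightarrow> real) \<Rightarrow> (int \<Rightarrow> real) \<Rightarrow> complex \<Rightarrow> (int \<Rightarrow> complex) \<Rightarrow> int \<Rightarrow> bool" where
  "jacobi_eq a b z F n \<longleftrightarrow>
     of_real (a (n - 1)) * F (n - 1) + of_real (b n) * F n + of_real (a n) * F (n + 1) = z * F n"

definition jacobi_solution ::
  "(int \<Rightarrow> real) \<Rightarrow> (int \<Rightarrow> real) \<Rightarrow> complex \<Rightarrow> (int \<Rightarrow> complex) \<Rightarrow> bool" where
  "jacobi_solution a b z F \<longleftrightarrow> (\<forall>n\<ge>0. jacobi_eq a b z F n)"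

definition wronskian ::
  "(int \<Rightarrow> real) \<Rightarrow> (int \<Rightarrow> complex) \<Rightarrow> (int \<Rightarrow> complex) \<Rightarrow> int \<Rightarrow> complex" where
  "wronskian a f g n = of_real (a n) * (f n * g (n + 1) - f (n + 1) * g n)"

definition second_G ::
  "(int \<Rightarrow> real) \<Rightarrow> (int \<Rightarrow> complex) \<Rightarrow> int \<Rightarrow> int \<Rightarrow> complex" where
  "second_G a f n0 n = (\<Sum>m=n0..n. inverse (of_real (a (m - 1)) * f (m - 1) * f m))"

(* Linear independence over the complex numbers of two sequences on {-1, 0, 1, ...}. It is
   spelled out because the general notion for the ambient space int => complex would also
   see the junk values below -1. *)
definition lin_indep_seqs :: "(int \<Rightarrow> complex) \<Rightarrow> (int \<Rightarrow> complex) \<Rightarrow> bool" where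
  "lin_indep_seqs f g \<longleftrightarrow>
     (\<forall>\<alpha> \<beta>. (\<forall>n\<ge>-1. \<alpha> * f n + \<beta> * g n = 0) \<longrightarrow> \<alpha> = 0 \<and> \<beta> = 0)"

end

theory Submission imports Defs begin

text \<open>The increment of \<open>G\<close> is chosen so that \<open>a\<^sub>n f\<^sub>n f\<^sub>n\<^sub>+\<^sub>1 (G\<^sub>n\<^sub>+\<^sub>1 - G\<^sub>n) = 1\<close>, that is, the Wronskian
  expression of \<open>f\<close> and \<open>f G\<close> equals \<open>1\<close> at every index. By Green's identity, constancy of the
  Wronskian and \<open>f\<^sub>n \<noteq> 0\<close> turn the Jacobi equation for \<open>f\<close> into the one for \<open>f G\<close>. Since
  \<open>a\<^sub>n \<noteq> 0\<close>, the equation can be solved for \<open>F\<^sub>n\<^sub>-\<^sub>1\<close>, which extends \<open>f G\<close> uniquely down to the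
  index \<open>-1\<close>.\<close>

lemma jacobi_eq_extend_down:
  fixes a b :: "int \<Rightarrow> real" and F :: "int \<Rightarrow> complex"
  assumes "\<And>n. n \<ge> -1 \<Longrightarrow> a n \<noteq> 0"
    and "\<And>n. n \<ge> int N \<Longrightarrow> jacobi_eq a b z F n"
  shows "\<exists>g. jacobi_solution a b z g \<and> (\<forall>n\<ge>int N - 1. g n = F n)"
  using assms(2)
proof (induction N arbitrary: F)
  case 0
  then show ?case by (auto simp: jacobi_solution_def)
next
  case (Suc N)
  let ?N = "int N"
  \<comment> \<open>The new value at \<open>?N - 1\<close> is forced by the equation at
    \<open>?N\<close>. The equations from \<open>?N + 1\<close> on do not involve this index, so
    they survive the overwriting.\<close>
  define F' where "F' = F(?N - 1 :=
    (z * F ?N - of_real (b ?N) * F ?N - of_real (a ?N) * F (?N + 1)) / of_real (a (?N - 1)))"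
  have "jacobi_eq a b z F' n" if "n \<ge> ?N" for n
  proof (cases "n = ?N")
    case True
    with assms(1)[of "?N - 1"] show ?thesis by (simp add: jacobi_eq_def F'_def)
  next
    case False
    with that Suc.prems[of n] show ?thesis by (simp add: jacobi_eq_def F'_def)
  qed
  from Suc.IH[OF this] obtain g where "jacobi_solution a b z g" "\<forall>n\<ge>?N - 1. g n = F' n"
    by blast
  then show ?case by (intro exI[of _ g]) (simp add: F'_def)
qed

lemma jacobi_solution_unique_down:
  fixes a b :: "int \<Rightarrow> real" and g h :: "int \<Rightarrow> complex"
  assumes "\<And>n. n \<ge> -1 \<Longrightarrow> a n \<noteq> 0"
    and "jacobi_solution a b z g" "jacobi_solution a b z h"
    and "\<And>n. n \<ge> int N - 1 \<Longrightarrow> h n = g n"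
    and "n \<ge> -1"
  shows "h n = g n"
  using assms(4)
proof (induction N)
  case 0
  then show ?case using assms(5) by simp
next
  case (Suc N)
  let ?N = "int N"
  \<comment> \<open>The right-hand side involves only the indices \<open>?N\<close> and
    \<open>?N + 1\<close>, where \<open>h\<close> and \<open>g\<close> already agree.\<close>
  have "of_real (a (?N - 1)) * F (?N - 1) =
      z * F ?N - of_real (b ?N) * F ?N - of_real (a ?N) * F (?N + 1)"
    if "jacobi_solution a b z F" for F
    using that[unfolded jacobi_solution_def, rule_format, of ?N]
    by (simp add: jacobi_eq_def algebra_simps)
  from this[OF assms(2)] this[OF assms(3)]
  have "of_real (a (?N - 1)) * h (?N - 1) = (of_real (a (?N - 1)) * g (?N - 1) :: complex)"
    using Suc.prems[of ?N] Suc.prems[of "?N + 1"] by simp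
  then have *: "h (?N - 1) = g (?N - 1)"
    using assms(1)[of "?N - 1"] by simp
  show ?case
  proof (rule Suc.IH)
    fix n assume "n \<ge> ?N - 1"
    then show "h n = g n"
      using Suc.prems[of n] * by (cases "n = ?N - 1") auto
  qed
qed

text \<open>Green's identity for arbitrary sequences: the terms with \<open>b n\<close> and
  \<open>z\<close> cancel between the two products. It serves both to show constancy for two
  solutions and, conversely, to recover the equation for \<open>g\<close> from constancy.\<close>

lemma wronskian_diff:
  "wronskian a f g n - wronskian a f g (n - 1) =
     f n * (of_real (a (n - 1)) * g (n - 1) + of_real (b n) * g n + of_real (a n) * g (n + 1) - z * g n)
     - g n * (of_real (a (n - 1)) * f (n - 1) + of_real (b n) * f n + of_real (a n) * f (n + 1) - z * f n)"
  by (simp add: wronskian_def algebra_simps)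

lemma wronskian_step:
  assumes "jacobi_eq a b z f n" "jacobi_eq a b z g n"
  shows "wronskian a f g (n - 1) = wronskian a f g n"
  using assms wronskian_diff[of a f g n b z] by (simp add: jacobi_eq_def)

lemma wronskian_const:
  assumes "jacobi_solution a b z f" "jacobi_solution a b z g" "n \<ge> -1"
  shows "wronskian a f g n = wronskian a f g (-1)"
  using assms(3)
proof (induction n rule: int_ge_induct)
  case (step i)
  then show ?case
    using wronskian_step[of a b z f "i + 1" g] assms(1,2) by (simp add: jacobi_solution_def)
qed simp

text \<open>The bound includes \<open>n0 - 1\<close>, where the sum is empty and equals 0.\<close>

lemma second_G_step:
  assumes "n \<ge> n0 - 1"
  shows "second_G a f n0 (n + 1) = second_G a f n0 n + inverse (of_real (a n) * f n * f (n + 1))"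
proof -
  have "{n0..n + 1} = insert (n + 1) {n0..n}"
    using assms by auto
  then show ?thesis by (simp add: second_G_def add.commute)
qed

lemma wronskian_second_G:
  assumes "n \<ge> n0 - 1" "a n \<noteq> 0" "f n \<noteq> 0" "f (n + 1) \<noteq> 0"
  shows "wronskian a f (\<lambda>k. f k * second_G a f n0 k) n = 1"
  using assms(2-) unfolding wronskian_def second_G_step[OF assms(1)] by (simp add: field_simps)

lemma jacobi_eq_second_G:
  assumes "jacobi_eq a b z f n" "n \<ge> n0"
    and "a (n - 1) \<noteq> 0" "a n \<noteq> 0" "f (n - 1) \<noteq> 0" "f n \<noteq> 0" "f (n + 1) \<noteq> 0"
  shows "jacobi_eq a b z (\<lambda>k. f k * second_G a f n0 k) n"
proof -
  let ?g = "\<lambda>k. f k * second_G a f n0 k"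
  have "wronskian a f ?g (n - 1) = wronskian a f ?g n"
    using assms by (simp add: wronskian_second_G)
  \<comment> \<open>The bracket of \<open>f\<close> in Green's identity vanishes, which leaves
    \<open>f n\<close> times the defect of \<open>?g\<close>.\<close>
  with assms(1) have "f n * (of_real (a (n - 1)) * ?g (n - 1) + of_real (b n) * ?g n
      + of_real (a n) * ?g (n + 1) - z * ?g n) = 0"
    using wronskian_diff[of a f ?g n b z] unfolding jacobi_eq_def by simp
  with assms(6) show ?thesis
    by (simp add: jacobi_eq_def)
qed

text \<open>Cramer's rule for the system in \<alpha>, \<beta> given by the indices \<open>n\<close>
  and \<open>n + 1\<close>; its determinant times \<open>a n\<close> is the Wronskian.\<close>

lemma lin_indep_seqs_wronskian:
  assumes "wronskian a f g n \<noteq> 0" "n \<ge> -1"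
  shows "lin_indep_seqs f g"
  unfolding lin_indep_seqs_def
proof (intro allI impI)
  fix \<alpha> \<beta> assume "\<forall>n\<ge>-1. \<alpha> * f n + \<beta> * g n = 0"
  then have 0: "\<alpha> * f n + \<beta> * g n = 0" "\<alpha> * f (n + 1) + \<beta> * g (n + 1) = 0"
    using assms(2) by simp_all
  have "\<alpha> * wronskian a f g n = of_real (a n) *
      (g (n + 1) * (\<alpha> * f n + \<beta> * g n) - g n * (\<alpha> * f (n + 1) + \<beta> * g (n + 1)))"
    "\<beta> * wronskian a f g n = of_real (a n) *
      (f n * (\<alpha> * f (n + 1) + \<beta> * g (n + 1)) - f (n + 1) * (\<alpha> * f n + \<beta> * g n))"
    by (simp_all add: wronskian_def algebra_simps)
  then have "\<alpha> * wronskian a f g n = 0" "\<beta> * wronskian a f g n = 0"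
    by (simp_all only: 0) simp_all
  with assms(1) show "\<alpha> = 0 \<and> \<beta> = 0" by simp
qed

theorem theorem4p8:
  fixes a b :: "int \<Rightarrow> real" and z :: complex and f :: "int \<Rightarrow> complex" and n0 :: int
  assumes "\<And>n. n \<ge> 0 \<Longrightarrow> a n > 0"
    and "a (-1) = 1/2"
    and "jacobi_solution a b z f"
    and "n0 \<ge> 0"
    and "\<And>n. n \<ge> n0 - 1 \<Longrightarrow> f n \<noteq> 0"
  shows "(\<forall>n\<ge>n0 + 1. jacobi_eq a b z (\<lambda>k. f k * second_G a f n0 k) n) \<and>
    (\<exists>g. jacobi_solution a b z g \<and>
         (\<forall>n\<ge>n0. g n = f n * second_G a f n0 n) \<and>
         (\<forall>h. jacobi_solution a b z h \<and> (\<forall>n\<ge>n0. h n = f n * second_G a f n0 n)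
              \<longrightarrow> (\<forall>n\<ge>-1. h n = g n)) \<and>
         (\<forall>n\<ge>-1. wronskian a f g n = 1) \<and>
         lin_indep_seqs f g)"
proof -
  let ?F = "\<lambda>k. f k * second_G a f n0 k"
  have a: "a n \<noteq> 0" if "n \<ge> -1" for n
    using assms(1)[of n] assms(2) that by (cases "n = -1") auto
  have F: "jacobi_eq a b z ?F n" if "n \<ge> n0 + 1" for n
    using assms(3,4) that
    by (intro jacobi_eq_second_G a assms(5)) (auto simp: jacobi_solution_def)
  \<comment> \<open>With this choice \<open>int N - 1\<close> is \<open>n0\<close>, so the extension
    downwards keeps all values from \<open>n0\<close> on.\<close>
  define N where "N = nat (n0 + 1)"
  have N: "int N = n0 + 1"
    using assms(4) by (simp add: N_def)
  obtain g where g: "jacobi_solution a b z g" "\<And>n. n \<ge> n0 \<Longrightarrow> g n = ?F n"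
    using jacobi_eq_extend_down[OF a F[folded N]] by (fastforce simp only: N add_diff_cancel_right')
  \<comment> \<open>Only the values at \<open>n0\<close> and \<open>n0 + 1\<close> enter, and there
    \<open>g\<close> is still given by the formula; constancy carries the value 1 to every index
    from -1 on.\<close>
  have "wronskian a f g n0 = wronskian a f ?F n0"
    using g(2) by (simp add: wronskian_def)
  also have "\<dots> = 1"
    using assms(4) by (intro wronskian_second_G a assms(5)) auto
  finally have W: "wronskian a f g n = 1" if "n \<ge> -1" for n
    using wronskian_const[OF assms(3) g(1) that] wronskian_const[OF assms(3) g(1), of n0] assms(4)
    by simp
  have "h n = g n"
    if "jacobi_solution a b z h" "\<forall>n\<ge>n0. h n = ?F n" "n \<ge> -1" for h n
  proof (rule jacobi_solution_unique_down[OF a g(1) that(1) _ that(3)])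
    show "h k = g k" if "k \<ge> int N - 1" for k
      using \<open>\<forall>n\<ge>n0. h n = ?F n\<close> g(2)[of k] N that by simp
  qed
  moreover have "lin_indep_seqs f g"
    using lin_indep_seqs_wronskian[of a f g 0] W by simp
  ultimately show ?thesis
    using F g W by blast
qed

end
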